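(* Let $m\ge1$ and let $\boldsymbol{X}$ and $\boldsymbol{N}=(N_1,\dots,N_m)^T$ be independent, square-integrable random vectors in $\mathbb{R}^m$ that are absolutely continuous with respect to Lebesgue measure, where $\boldsymbol{N}$ has a density $p_{\boldsymbol{N}}$ for which there is a constant $C$ with $p_{\boldsymbol{N}}(\boldsymbol{u})\le\frac{C}{1+\|\boldsymbol{u}\|^{m+2}}$ for all $\boldsymbol{u}\in\mathbb{R}^m$. Then $$\lim_{t\to\infty}t\cdot\mathrm{mmse}(\boldsymbol{X}\mid\sqrt{t}\boldsymbol{X}+\boldsymbol{N})=\mathrm{tr}\,\Sigma_{\boldsymbol{N}}=\sum_{i=1}^m\sigma_{N_i}^2.$$
   Context: $\mathrm{mmse}(\boldsymbol{X}\mid\boldsymbol{Y}):=\mathbb{E}\|\boldsymbol{X}-\mathbb{E}[\boldsymbol{X}\mid\boldsymbol{Y}]\|^2$ with $\|\cdot\|$ the Euclidean norm; $\Sigma_{\boldsymbol{N}}$ is the covariance matrix of $\boldsymbol{N}$ and $\sigma_{N_i}^2$ the variance of $N_i$. *)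

theory Defs
  imports "HOL-Probability.Probability"
begin

definition vec_cond_exp :: "'a measure \<Rightarrow> ('a \<Rightarrow> real^'m) \<Rightarrow> ('a \<Rightarrow> 'b::topological_space) \<Rightarrow> 'a \<Rightarrow> real^'m" where
  "vec_cond_exp M X Y = (\<lambda>\<omega>. \<chi> i. real_cond_exp M (vimage_algebra (space M) Y borel) (\<lambda>\<omega>'. X \<omega>' $ i) \<omega>)"

definition mmse :: "'a measure \<Rightarrow> ('a \<Rightarrow> real^'m) \<Rightarrow> ('a \<Rightarrow> 'b::topological_space) \<Rightarrow> real" where
  "mmse M X Y = (\<integral>\<omega>. (norm (X \<omega> - vec_cond_exp M X Y \<omega>))\<^sup>2 \<partial>M)"

definition var :: "'a measure \<Rightarrow> ('a \<Rightarrow> real) \<Rightarrow> real" where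
  "var M f = (\<integral>\<omega>. (f \<omega> - (\<integral>\<omega>'. f \<omega>' \<partial>M))\<^sup>2 \<partial>M)"

end

theory Submission
  imports Defs
begin

text \<open>
  Put \<open>Y = sqrt t X + N\<close> and \<open>W = N - E N\<close>. Since \<open>X\<close> is \<open>Y / sqrt t\<close> minus \<open>N / sqrt t\<close>, the
  error \<open>X - E[X | Y]\<close> is \<open>-(W - E[W | Y]) / sqrt t\<close>, so that \<open>t\<close> times the mmse equals
  \<open>tr \<Sigma>\<^sub>N - E |E[W | Y]|\<^sup>2\<close>, and it suffices that the last term vanishes in the limit.
  After truncation, \<open>W\<close> is replaced by a bounded centred function \<open>h N\<close>, and it is enough to show that
  \<open>E[h N; Y \<in> B]\<close> tends to \<open>0\<close> uniformly in the Borel set \<open>B\<close>. By independence this is the integral of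
  \<open>h n\<close> against \<open>P (sqrt t X + n \<in> B) - P (sqrt t X \<in> B)\<close>. After rescaling by \<open>sqrt t\<close>, that
  difference compares the law of \<open>X\<close> with its translate by the small vector \<open>n / sqrt t\<close>. It is small
  uniformly in \<open>B\<close> because translation is continuous in \<open>L\<^sup>1\<close>, applied to the density of \<open>X\<close>.
\<close>

section \<open>Continuity of translation in L^1, and translates of absolutely continuous
  laws\<close>

lemma lborel_integral_translate:
  fixes f :: "'a::euclidean_space \<Rightarrow> real"
  assumes [measurable]: "f \<in> borel_measurable borel"
  shows "integrable lborel (\<lambda>y. f (y - a)) \<longleftrightarrow> integrable lborel f"
    and "(\<integral>y. f (y - a) \<partial>lborel) = (\<integral>y. f y \<partial>lborel)"
proof -
  have L: "lborel = distr lborel borel (\<lambda>y. y - a)"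
    using lborel_distr_plus[of "-a"] by (simp cong: distr_cong)
  show "integrable lborel (\<lambda>y. f (y - a)) \<longleftrightarrow> integrable lborel f"
    by (subst (2) L, subst integrable_distr_eq) auto
  show "(\<integral>y. f (y - a) \<partial>lborel) = (\<integral>y. f y \<partial>lborel)"
    by (subst (2) L, subst integral_distr) auto
qed

text \<open>Inner regularity is applied to the finite measure \<open>D\<close>, Lebesgue measure
  restricted to \<open>A\<close>, which agrees with Lebesgue measure on the compact subsets of
  \<open>A\<close>.\<close>

lemma finite_lborel_inner_compact:
  fixes A :: "'a::euclidean_space set"
  assumes A: "A \<in> sets borel" and fin: "emeasure lborel A < \<infinity>" and "0 < (e::real)"
  obtains K where "compact K" "K \<subseteq> A" "measure lborel (A - K) < e"
proof -
  define D where "D = density lborel (indicator A :: 'a \<Rightarrow> ennreal)"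
  have em: "emeasure D B = emeasure lborel (A \<inter> B)" if "B \<in> sets borel" for B
    using that A by (simp add: D_def emeasure_density flip: indicator_inter_arith)
  have "emeasure D A = (SUP K \<in> {K. K \<subseteq> A \<and> compact K}. emeasure D K)"
    by (rule inner_regular) (use em[of UNIV] fin A in \<open>auto simp: D_def\<close>)
  then have eq: "emeasure lborel A = (SUP K \<in> {K. K \<subseteq> A \<and> compact K}. emeasure D K)"
    using em[OF A] by simp
  show thesis
  \<comment> \<open>Subtraction in \<open>ennreal\<close> is truncated at 0, so lowering the measure
    of \<open>A\<close> by \<open>e\<close> is a strict decrease only if that measure is
    positive.\<close>
  proof (cases "emeasure lborel A = 0")
    case True
    then have "measure lborel A = 0" by (simp add: measure_def)
    with that[of "{}"] show ?thesis using \<open>0 < e\<close> by simp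
  next
    case False
    have "emeasure lborel A - ennreal e < emeasure lborel A"
      using fin \<open>0 < e\<close> False by (intro ennreal_between) (auto simp: zero_less_iff_neq_zero)
    then obtain K where K: "K \<subseteq> A" "compact K" and lt: "emeasure lborel A - ennreal e < emeasure D K"
      unfolding eq less_SUP_iff by auto
    have [measurable]: "K \<in> sets borel" using K by (simp add: compact_imp_closed borel_closed)
    have "emeasure D K = emeasure lborel K" using em[of K] K by (simp add: Int_absorb1)
    moreover have fK: "emeasure lborel K < \<infinity>"
      by (rule le_less_trans[OF emeasure_mono fin]) (use K A in auto)
    ultimately have "ennreal (measure lborel A - e) < ennreal (measure lborel K)"
      using lt fin \<open>0 < e\<close> by (simp add: emeasure_eq_ennreal_measure ennreal_minus)
    then have "measure lborel A - e < measure lborel K"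
      by (meson ennreal_leI not_le)
    then have "measure lborel (A - K) < e"
      using A fin K by (subst measure_Diff) auto
    then show ?thesis using that K by blast
  qed
qed

text \<open>Squeeze a compact \<open>K\<close> inside \<open>A\<close> and an open \<open>U\<close>
  around \<open>K\<close>. A short shift keeps \<open>K\<close> inside \<open>U\<close>, which is
  barely larger than \<open>K\<close>, while the part of \<open>A\<close> outside \<open>K\<close>
  is small and keeps its measure under translation.\<close>

lemma L1_translate_indicator:
  fixes A :: "'a::euclidean_space set"
  assumes A[measurable]: "A \<in> sets borel" and fin: "emeasure lborel A < \<infinity>" and "0 < (e::real)"
  shows "\<exists>d>0. \<forall>a. norm a < d \<longrightarrow> (\<integral>y. \<bar>indicator A (y - a) - indicator A y\<bar> \<partial>lborel) \<le> e"
proof -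
  obtain K where K: "compact K" "K \<subseteq> A" "measure lborel (A - K) < e/4"
    using finite_lborel_inner_compact[OF A fin, of "e/4"] \<open>0 < e\<close> by auto
  have [measurable]: "K \<in> sets borel" using K by (simp add: compact_imp_closed borel_closed)
  obtain U where U: "open U" "K \<subseteq> U" "emeasure lborel (U - K) < ennreal (e/4)"
    using outer_regular_lborel[of K "e/4"] \<open>0 < e\<close> by auto
  have [measurable]: "U \<in> sets borel" using U by simp
  have UK: "measure lborel (U - K) \<le> e/4" and fUK: "emeasure lborel (U - K) < \<infinity>"
    unfolding measure_def using U(3) \<open>0 < e\<close>
    by (intro enn2real_leI, auto intro: order.strict_trans simp: ennreal_less_top)
  have fAK: "emeasure lborel (A - K) < \<infinity>"
    by (rule le_less_trans[OF emeasure_mono fin]) auto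
  have fK: "emeasure lborel K < \<infinity>"
    by (rule le_less_trans[OF emeasure_mono fin]) (use K in auto)
  obtain d where d: "d > 0" "\<And>x. x \<in> K \<Longrightarrow> ball x d \<subseteq> U"
  proof (cases "K = {}")
    case True then show ?thesis using that[of 1] by simp
  next
    case False
    then show ?thesis using compact_subset_open_imp_ball_epsilon_subset[OF K(1) U(1,2)] that
      by (metis UN_subset_iff)
  qed
  have ii: "integrable lborel (\<lambda>y. indicator B y :: real)" "integrable lborel (\<lambda>y. indicator B (y - a) :: real)"
    if "B \<in> sets borel" "emeasure lborel B < \<infinity>" for B and a :: 'a
    using that by (auto simp: lborel_integral_translate(1)[of "indicator B"])
  have "(\<integral>y. \<bar>indicator A (y - a) - indicator A y\<bar> \<partial>lborel) \<le> e" if a: "norm a < d" for a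
  proof -
    \<comment> \<open>The bracket dominates the change of \<open>indicator K\<close>, because
      \<open>y\<close> lies in \<open>U\<close> whenever \<open>y - a\<close> lies in
      \<open>K\<close>. It avoids absolute values so that the two \<open>K\<close> terms cancel on
      integration, leaving at most \<open>2 * (e/4) + 2 * (e/4)\<close>.\<close>
    have pt: "\<bar>indicator A (y - a) - indicator A y :: real\<bar> \<le>
       (2 * indicator (U - K) y + indicator K y - indicator K (y - a))
        + indicator (A - K) (y - a) + indicator (A - K) y" for y
    proof -
      have "y \<in> U" if "y - a \<in> K"
        using d(2)[OF that] a by (auto simp: dist_norm subset_iff)
      then show ?thesis using K(2) U(2) by (auto simp: indicator_def)
    qed
    have "(\<integral>y. \<bar>indicator A (y - a) - indicator A y :: real\<bar> \<partial>lborel) \<le>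
      (\<integral>y. (2 * indicator (U - K) y + indicator K y - indicator K (y - a))
        + indicator (A - K) (y - a) + indicator (A - K) y \<partial>lborel)"
      by (intro integral_mono pt integrable_abs Bochner_Integration.integrable_diff
          Bochner_Integration.integrable_add integrable_mult_right ii) (use fin fK fAK fUK in auto)
    also have "\<dots> = 2 * measure lborel (U - K) + 2 * measure lborel (A - K)"
      using fin fK fAK fUK
      by (simp add: ii lborel_integral_translate(2)[of "indicator K"] lborel_integral_translate(2)[of "indicator (A-K)"])
    also have "\<dots> \<le> e" using UK K(3) by simp
    finally show ?thesis .
  qed
  with d(1) show ?thesis by blast
qed

text \<open>The functions with this property form a closed subspace of L^1, closed because
  translation is an isometry there. It contains the indicators of sets of finite measure, which is
  enough for the induction on integrable functions.\<close>

lemma L1_translate_continuous: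
  fixes f :: "'a::euclidean_space \<Rightarrow> real"
  assumes "integrable lborel f" and "0 < e"
  shows "\<exists>d>0. \<forall>a. norm a < d \<longrightarrow> (\<integral>y. \<bar>f (y - a) - f y\<bar> \<partial>lborel) \<le> e"
  using assms
proof (induction arbitrary: e rule: integrable_induct)
  case (base A c)
  then have A: "A \<in> sets borel" by simp
  \<comment> \<open>The \<open>+ 1\<close> keeps the quotient meaningful when
    \<open>c = 0\<close>.\<close>
  obtain d where d: "d > 0" "\<And>a. norm a < d \<Longrightarrow>
      (\<integral>y. \<bar>indicator A (y - a) - indicator A y\<bar> \<partial>lborel) \<le> e / (\<bar>c\<bar> + 1)"
    using L1_translate_indicator[OF A base(2), of "e / (\<bar>c\<bar> + 1)"] base(3) by auto
  have "(\<integral>y. \<bar>indicator A (y - a) *\<^sub>R c - indicator A y *\<^sub>R c\<bar> \<partial>lborel) \<le> e" if "norm a < d" for a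
  proof -
    have "(\<integral>y. \<bar>indicator A (y - a) *\<^sub>R c - indicator A y *\<^sub>R c\<bar> \<partial>lborel)
      = \<bar>c\<bar> * (\<integral>y. \<bar>indicator A (y - a) - indicator A y\<bar> \<partial>lborel)"
      by (subst integral_mult_right_zero[symmetric], rule Bochner_Integration.integral_cong)
        (auto simp: abs_mult mult.commute[of _ c] right_diff_distrib[symmetric])
    also have "\<dots> \<le> \<bar>c\<bar> * (e / (\<bar>c\<bar> + 1))" using d(2)[OF that] by (intro mult_left_mono) auto
    also have "\<dots> \<le> e" using base(3) by (simp add: field_simps)
    finally show ?thesis .
  qed
  with d(1) show ?case by blast
next
  case (add f g)
  have fm[measurable]: "f \<in> borel_measurable borel" "g \<in> borel_measurable borel"
    using add.hyps[THEN borel_measurable_integrable] by auto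
  obtain d1 where d1: "d1 > 0" "\<And>a. norm a < d1 \<Longrightarrow> (\<integral>y. \<bar>f (y - a) - f y\<bar> \<partial>lborel) \<le> e/2"
    using add.IH(1)[of "e/2"] add.prems by auto
  obtain d2 where d2: "d2 > 0" "\<And>a. norm a < d2 \<Longrightarrow> (\<integral>y. \<bar>g (y - a) - g y\<bar> \<partial>lborel) \<le> e/2"
    using add.IH(2)[of "e/2"] add.prems by auto
  have "(\<integral>y. \<bar>(f (y - a) + g (y - a)) - (f y + g y)\<bar> \<partial>lborel) \<le> e" if "norm a < min d1 d2" for a
  proof -
    have i: "integrable lborel (\<lambda>y. f (y - a))" "integrable lborel (\<lambda>y. g (y - a))"
      using add.hyps by (simp_all add: lborel_integral_translate(1))
    have "(\<integral>y. \<bar>(f (y - a) + g (y - a)) - (f y + g y)\<bar> \<partial>lborel)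
       \<le> (\<integral>y. \<bar>f (y - a) - f y\<bar> + \<bar>g (y - a) - g y\<bar> \<partial>lborel)"
      using i add.hyps by (intro integral_mono) auto
    also have "\<dots> = (\<integral>y. \<bar>f (y - a) - f y\<bar> \<partial>lborel) + (\<integral>y. \<bar>g (y - a) - g y\<bar> \<partial>lborel)"
      using i add.hyps by (intro Bochner_Integration.integral_add) auto
    also have "\<dots> \<le> e" using d1(2)[of a] d2(2)[of a] that by auto
    finally show ?thesis .
  qed
  with d1(1) d2(1) show ?case by (intro exI[of _ "min d1 d2"]) auto
next
  case (lim f s)
  have [measurable]: "f \<in> borel_measurable borel" "\<And>i. s i \<in> borel_measurable borel"
    using lim.hyps(1,4)[THEN borel_measurable_integrable] by auto
  have "(\<lambda>i. \<integral>y. \<bar>s i y - f y\<bar> \<partial>lborel) \<longlonglongrightarrow> (\<integral>y. 0 \<partial>(lborel :: 'a measure))"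
  \<comment> \<open>The approximants satisfy \<open>norm (s i x) \<le> 2 * norm (f x)\<close>, which
    gives the factor 3.\<close>
  proof (rule integral_dominated_convergence[where w = "\<lambda>y. 3 * \<bar>f y\<bar>"])
    show "AE x in lborel. (\<lambda>i. \<bar>s i x - f x\<bar>) \<longlonglongrightarrow> 0"
      using lim.hyps(2) by (auto intro!: AE_I2 tendsto_rabs_zero simp: LIM_zero_iff)
    show "AE x in lborel. norm \<bar>s i x - f x\<bar> \<le> 3 * \<bar>f x\<bar>" for i
    proof (rule AE_I2)
      fix x :: 'a
      show "norm \<bar>s i x - f x\<bar> \<le> 3 * \<bar>f x\<bar>" using lim.hyps(3)[of x i] by auto
    qed
  qed (use lim.hyps(4) in auto)
  then have "\<forall>\<^sub>F i in sequentially. (\<integral>y. \<bar>s i y - f y\<bar> \<partial>lborel) < e/3"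
    using lim.prems by (intro order_tendstoD(2)) auto
  then obtain i where i: "(\<integral>y. \<bar>s i y - f y\<bar> \<partial>lborel) < e/3"
    using eventually_happens by fastforce
  obtain d where d: "d > 0" "\<And>a. norm a < d \<Longrightarrow> (\<integral>y. \<bar>s i (y - a) - s i y\<bar> \<partial>lborel) \<le> e/3"
    using lim.IH[of "e/3" i] lim.prems by auto
  have "(\<integral>y. \<bar>f (y - a) - f y\<bar> \<partial>lborel) \<le> e" if a: "norm a < d" for a
  proof -
    have j: "integrable lborel (\<lambda>y. f (y - a))" "integrable lborel (\<lambda>y. s i (y - a))"
      using lim.hyps(1,4) by (simp_all add: lborel_integral_translate(1))
    \<comment> \<open>The triangle inequality passes through \<open>s i (y - a)\<close> and
      \<open>s i y\<close>. By translation invariance the first and the third term have the same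
      integral, so each of the three contributes at most \<open>e/3\<close>.\<close>
    have "(\<integral>y. \<bar>f (y - a) - f y\<bar> \<partial>lborel) \<le>
       (\<integral>y. \<bar>s i (y - a) - f (y - a)\<bar> + \<bar>s i (y - a) - s i y\<bar> + \<bar>s i y - f y\<bar> \<partial>lborel)"
      using j lim.hyps(1,4) by (intro integral_mono integrable_abs Bochner_Integration.integrable_diff
          Bochner_Integration.integrable_add) auto
    also have "\<dots> = (\<integral>y. \<bar>s i (y - a) - f (y - a)\<bar> \<partial>lborel) + (\<integral>y. \<bar>s i (y - a) - s i y\<bar> \<partial>lborel)
         + (\<integral>y. \<bar>s i y - f y\<bar> \<partial>lborel)"
      using j lim.hyps(1,4) by simp
    also have "(\<integral>y. \<bar>s i (y - a) - f (y - a)\<bar> \<partial>lborel) = (\<integral>y. \<bar>s i y - f y\<bar> \<partial>lborel)"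
      by (rule lborel_integral_translate(2)[of "\<lambda>y. \<bar>s i y - f y\<bar>"]) simp
    finally show ?thesis using i d(2)[OF a] by linarith
  qed
  with d(1) show ?case by blast
qed

text \<open>With a density \<open>f\<close> of \<open>P\<close>, the difference is the integral of
  \<open>f (x - a) - f x\<close> over \<open>B\<close>. The L^1 norm of the integrand bounds it for
  all \<open>B\<close> at once, so \<open>d\<close> can be chosen before \<open>B\<close>.\<close>

lemma abs_cont_measure_translate:
  fixes P :: "'a::euclidean_space measure"
  assumes fin: "finite_measure P" and S: "sets P = sets borel" and ac: "absolutely_continuous lborel P"
    and "0 < (e::real)"
  shows "\<exists>d>0. \<forall>a. norm a < d \<longrightarrow> (\<forall>B\<in>sets borel. \<bar>measure P {x. x + a \<in> B} - measure P B\<bar> \<le> e)"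
proof -
  interpret finite_measure P by fact
  \<comment> \<open>The Radon-Nikodym derivative is replaced by a real-valued, everywhere
    nonnegative version; finiteness of \<open>P\<close> then makes it integrable.\<close>
  obtain f where f: "f \<in> borel_measurable lborel" "\<And>x. 0 \<le> f x" "density lborel (\<lambda>x. ennreal (f x)) = P"
  proof -
    obtain D where D: "D \<in> borel_measurable lborel" "AE x in lborel. RN_deriv lborel P x = ennreal (D x)"
      "\<And>x. 0 \<le> D x"
      by (rule sigma_finite_measure.real_RN_deriv[OF sigma_finite_lborel fin ac]) (use S in auto)
    have "density lborel (\<lambda>x. ennreal (D x)) = density lborel (RN_deriv lborel P)"
      using D by (intro density_cong) auto
    also have "\<dots> = P"
      using sigma_finite_measure.density_RN_deriv[OF sigma_finite_lborel ac] S by simp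
    finally show ?thesis using that D by blast
  qed
  have [measurable]: "f \<in> borel_measurable borel" using f(1) by simp
  have "(\<integral>\<^sup>+x. ennreal (f x) \<partial>lborel) = emeasure P UNIV"
    unfolding f(3)[symmetric] by (subst emeasure_density) auto
  also have "\<dots> < \<infinity>" using emeasure_finite by (simp add: less_top[symmetric])
  finally have fi: "integrable lborel f"
    using f(2) by (intro integrableI_nonneg) auto
  have ms: "measure P B = (\<integral>x. indicator B x * f x \<partial>lborel)" if [measurable]: "B \<in> sets borel" for B
  proof -
    have "measure P B = (\<integral>x. indicator B x \<partial>P)" using S that by simp
    also have "\<dots> = (\<integral>x. f x *\<^sub>R indicator B x \<partial>lborel)"
      unfolding f(3)[symmetric] using f(2) by (intro integral_density) auto
    finally show ?thesis by (simp add: mult.commute)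
  qed
  obtain d where d: "d > 0" "\<And>a. norm a < d \<Longrightarrow> (\<integral>y. \<bar>f (y - a) - f y\<bar> \<partial>lborel) \<le> e"
    using L1_translate_continuous[OF fi \<open>0 < e\<close>] by auto
  have "\<bar>measure P {x. x + a \<in> B} - measure P B\<bar> \<le> e" if a: "norm a < d" and [measurable]: "B \<in> sets borel" for a B
  proof -
    have i: "integrable lborel (\<lambda>y. f (y - a))" using fi by (simp add: lborel_integral_translate(1))
    have ib: "integrable lborel (\<lambda>y. indicator B y * g y)" if "integrable lborel g" for g :: "'a \<Rightarrow> real"
      using integrable_mult_indicator[of B lborel g] that by simp
    have "measure P {x. x + a \<in> B} = (\<integral>x. indicator {x. x + a \<in> B} x * f x \<partial>lborel)"
      by (rule ms) measurable
    also have "\<dots> = (\<integral>x. indicator B ((x + a)) * f x \<partial>lborel)" by (simp add: indicator_def)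
    also have "\<dots> = (\<integral>x. indicator B x * f (x - a) \<partial>lborel)"
      using lborel_integral_translate(2)[of "\<lambda>x. indicator B (x + a) * f x" a] by simp
    finally have "measure P {x. x + a \<in> B} - measure P B
        = (\<integral>x. indicator B x * f (x - a) - indicator B x * f x \<partial>lborel)"
      using ms[of B] ib[OF i] ib[OF fi] by simp
    also have "\<bar>\<dots>\<bar> \<le> (\<integral>x. \<bar>f (x - a) - f x\<bar> \<partial>lborel)"
      using ib[OF i] ib[OF fi] i fi
      by (intro integral_abs_bound[THEN order_trans] integral_mono) (auto simp: indicator_def)
    finally show ?thesis using d(2)[OF a] by linarith
  qed
  with d(1) show ?thesis by blast
qed

section \<open>Asymptotic decorrelation of the noise from events of the observation\<close>

text \<open>Each point leaves the tail sets once \<open>k\<close> reaches \<open>g x\<close>, so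
  dominated convergence applies. This serves to cut off both long noise vectors and large values of
  \<open>h\<close>.\<close>

lemma integral_tail_tendsto_zero:
  fixes f g :: "'a \<Rightarrow> real"
  assumes f: "integrable M f" and [measurable]: "g \<in> borel_measurable M"
  shows "(\<lambda>k. \<integral>x. indicator {x. real k < g x} x * f x \<partial>M) \<longlonglongrightarrow> 0"
proof -
  have "(\<lambda>k. \<integral>x. indicator {x. real k < g x} x * f x \<partial>M) \<longlonglongrightarrow> (\<integral>x. 0 \<partial>M)"
  proof (rule integral_dominated_convergence[where w = "\<lambda>x. \<bar>f x\<bar>"])
    show "AE x in M. (\<lambda>k. indicator {x. real k < g x} x * f x) \<longlonglongrightarrow> 0"
    proof (rule AE_I2)
      fix x
      obtain n where "g x \<le> real n" using real_arch_simple by blast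
      then have "\<forall>\<^sub>F k in sequentially. indicator {x. real k < g x} x * f x = 0"
        by (auto simp: eventually_sequentially intro!: exI[of _ n])
      then show "(\<lambda>k. indicator {x. real k < g x} x * f x) \<longlonglongrightarrow> 0" by (rule tendsto_eventually)
    qed
  qed (use f in \<open>auto simp: indicator_def\<close>)
  then show ?thesis by simp
qed

text \<open>The threshold for \<open>t\<close> must not depend on \<open>B\<close>: in the
  application \<open>B\<close> describes a level set of a conditional expectation that itself varies
  with \<open>t\<close>.\<close>

lemma (in prob_space) indep_noise_asymp_uncorrelated:
  fixes X N :: "'a \<Rightarrow> 'b::euclidean_space" and h :: "'b \<Rightarrow> real"
  assumes [measurable]: "random_variable borel X" "random_variable borel N" "h \<in> borel_measurable borel"
    and ind: "indep_var borel X borel N" and ac: "absolutely_continuous lborel (distr M lborel X)"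
    and hR: "\<And>n. \<bar>h n\<bar> \<le> R" and h0: "expectation (\<lambda>\<omega>. h (N \<omega>)) = 0" and "0 < e"
  shows "\<forall>\<^sub>F t in at_top. \<forall>B\<in>sets borel.
      \<bar>expectation (\<lambda>\<omega>. indicator B (sqrt t *\<^sub>R X \<omega> + N \<omega>) * h (N \<omega>))\<bar> \<le> e"
proof -
  define P Q where "P = distr M borel X" and "Q = distr M borel N"
  have sP[measurable_cong, simp]: "sets P = sets borel" "sets Q = sets borel" by (auto simp: P_def Q_def)
  interpret P: prob_space P unfolding P_def by (rule prob_space_distr) simp
  interpret Q: prob_space Q unfolding Q_def by (rule prob_space_distr) simp
  interpret PQ: pair_prob_space P Q ..
  have R: "0 \<le> R" using hR[of 0] by linarith
  \<comment> \<open>Two errors of size \<open>c\<close>, each weighted by \<open>R\<close>, have to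
    add up to at most \<open>e\<close>; \<open>R + 1\<close> in place of \<open>R\<close> covers
    \<open>R = 0\<close>.\<close>
  define c where "c = e / (2 * (R + 1))"
  have c: "0 < c" using \<open>0 < e\<close> R by (simp add: c_def)
  have "\<forall>\<^sub>F k in sequentially. (\<integral>n. indicator {n. real k < norm n} n * 1 \<partial>Q) < c"
    using integral_tail_tendsto_zero[of Q "\<lambda>_. 1" norm] c by (intro order_tendstoD(2)) auto
  then obtain k where k: "(\<integral>n. indicator {n. real k < norm n} n \<partial>Q) < c"
    using eventually_happens by fastforce
  have acP: "absolutely_continuous lborel P"
    using ac by (simp add: P_def cong: distr_cong)
  obtain d where d: "d > 0" "\<And>a B. norm a < d \<Longrightarrow> B \<in> sets borel \<Longrightarrow>
      \<bar>measure P {x. x + a \<in> B} - measure P B\<bar> \<le> c"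
    using abs_cont_measure_translate[OF P.finite_measure_axioms sP(1) acP c] by blast
  \<comment> \<open>Here \<open>s\<close> stands for \<open>sqrt t\<close>. The condition
    \<open>k / d < s\<close> makes noise of length at most \<open>k\<close> a shift
    \<open>n /\<^sub>R s\<close> shorter than \<open>d\<close>.\<close>
  have "\<bar>expectation (\<lambda>\<omega>. indicator B (s *\<^sub>R X \<omega> + N \<omega>) * h (N \<omega>))\<bar> \<le> e"
    if s: "s > 0" "k / d < s" and [measurable]: "B \<in> sets borel" for s B
  proof -
    \<comment> \<open>The subtracted term does not depend on \<open>n\<close>, so it integrates to 0
      against the centred \<open>h\<close>.\<close>
    define G where "G n = measure P {x. s *\<^sub>R x + n \<in> B} - measure P {x. s *\<^sub>R x \<in> B}" for n
    have mm[measurable]: "(\<lambda>n. measure P {x. s *\<^sub>R x + n \<in> B}) \<in> borel_measurable borel"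
    proof -
      have "(\<lambda>n. \<integral>x. (indicator B (s *\<^sub>R x + n) :: real) \<partial>P) \<in> borel_measurable borel"
        by measurable
      moreover have "(\<integral>x. indicator B (s *\<^sub>R x + n) \<partial>P) = measure P {x. s *\<^sub>R x + n \<in> B}" for n
      proof -
        have "(\<integral>x. (indicator B (s *\<^sub>R x + n) :: real) \<partial>P) = (\<integral>x. indicator {x. s *\<^sub>R x + n \<in> B} x \<partial>P)"
          by (intro Bochner_Integration.integral_cong) (auto simp: indicator_def)
        then show ?thesis by simp
      qed
      ultimately show ?thesis by simp
    qed
    \<comment> \<open>Long noise is rare and gets the trivial bound 1 for a difference of
      probabilities; all other noise falls under the shift estimate.\<close>
    have Gb: "\<bar>G n\<bar> \<le> c + indicator {n. real k < norm n} n" for n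
    proof (cases "real k < norm n")
      case True
      have "0 \<le> measure P C \<and> measure P C \<le> 1" for C using P.prob_le_1 by simp
      then have "\<bar>G n\<bar> \<le> 1" unfolding G_def by (smt (verit))
      then show ?thesis using c True by simp
    next
      case False
      have "norm (n /\<^sub>R s) < d"
        using False s d(1) by (simp add: field_simps)
      moreover have "{x. s *\<^sub>R x \<in> B} \<in> sets borel" by measurable
      \<comment> \<open>After division by \<open>s\<close>, the set \<open>B\<close> becomes its
        preimage under scaling. This Borel set changes with \<open>s\<close>, which is where
        uniformity over Borel sets enters.\<close>
      ultimately have "\<bar>measure P {x. x + n /\<^sub>R s \<in> {x. s *\<^sub>R x \<in> B}} - measure P {x. s *\<^sub>R x \<in> B}\<bar> \<le> c"
        by (rule d(2))
      then show ?thesis using False s by (simp add: G_def scaleR_add_right)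
    qed
    have iQ: "integrable Q (\<lambda>n. h n * measure P {x. s *\<^sub>R x + n \<in> B})" "integrable Q h"
      "integrable Q (\<lambda>n. \<bar>h n\<bar> * (c + indicator {n. real k < norm n} n))" "integrable Q (\<lambda>n. h n * G n)"
    proof -
      show "integrable Q h" by (rule Q.integrable_const_bound[of _ R]) (auto simp: hR)
      show "integrable Q (\<lambda>n. h n * measure P {x. s *\<^sub>R x + n \<in> B})"
        by (rule Q.integrable_const_bound[of _ R])
          (auto simp: abs_mult intro!: order_trans[OF mult_mono[OF hR P.prob_le_1]] simp: R)
      have "\<bar>h n\<bar> * (c + indicator {n. real k < norm n} n) \<le> R * (c + 1)" for n
        using hR[of n] c R by (intro mult_mono) (auto simp: indicator_def)
      then show "integrable Q (\<lambda>n. \<bar>h n\<bar> * (c + indicator {n. real k < norm n} n))"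
        using c by (intro Q.integrable_const_bound[of _ "R * (c + 1)"]) (auto simp: abs_mult)
      then show "integrable Q (\<lambda>n. h n * G n)"
      proof (rule Bochner_Integration.integrable_bound)
        show "(\<lambda>n. h n * G n) \<in> borel_measurable Q" unfolding G_def by measurable
        show "AE n in Q. norm (h n * G n) \<le> norm (\<bar>h n\<bar> * (c + indicator {n. real k < norm n} n))"
        proof (rule AE_I2)
          fix n
          have "\<bar>h n\<bar> * \<bar>G n\<bar> \<le> \<bar>h n\<bar> * (c + indicator {n. real k < norm n} n)"
            by (intro mult_left_mono Gb) simp
          then show "norm (h n * G n) \<le> norm (\<bar>h n\<bar> * (c + indicator {n. real k < norm n} n))"
            using c by (simp add: abs_mult)
        qed
      qed
    qed
    have "expectation (\<lambda>\<omega>. indicator B (s *\<^sub>R X \<omega> + N \<omega>) * h (N \<omega>))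
       = (\<integral>z. indicator B (s *\<^sub>R fst z + snd z) * h (snd z) \<partial>distr M (borel \<Otimes>\<^sub>M borel) (\<lambda>\<omega>. (X \<omega>, N \<omega>)))"
      by (subst integral_distr) auto
    \<comment> \<open>Independence makes the joint law a product, so Fubini can integrate out
      \<open>X\<close> with the noise frozen at \<open>n\<close>.\<close>
    also have "distr M (borel \<Otimes>\<^sub>M borel) (\<lambda>\<omega>. (X \<omega>, N \<omega>)) = P \<Otimes>\<^sub>M Q"
      using ind by (simp add: indep_var_distribution_eq P_def Q_def)
    also have "(\<integral>z. indicator B (s *\<^sub>R fst z + snd z) * h (snd z) \<partial>(P \<Otimes>\<^sub>M Q))
       = (\<integral>n. \<integral>x. indicator B (s *\<^sub>R x + n) * h n \<partial>P \<partial>Q)"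
    proof -
      have "integrable (P \<Otimes>\<^sub>M Q) (\<lambda>z. indicator B (s *\<^sub>R fst z + snd z) * h (snd z))"
        by (rule PQ.integrable_const_bound[of _ R]) (auto simp: abs_mult indicator_def hR R)
      then show ?thesis
        using PQ.integral_snd[where f = "\<lambda>x n. indicator B (s *\<^sub>R x + n) * h n"]
        by (simp add: case_prod_beta')
    qed
    also have "\<dots> = (\<integral>n. h n * measure P {x. s *\<^sub>R x + n \<in> B} \<partial>Q)"
    proof (rule Bochner_Integration.integral_cong)
      fix n
      have "(\<integral>x. indicator B (s *\<^sub>R x + n) * h n \<partial>P) = (\<integral>x. indicator {x. s *\<^sub>R x + n \<in> B} x * h n \<partial>P)"
        by (intro Bochner_Integration.integral_cong) (auto simp: indicator_def)
      then show "(\<integral>x. indicator B (s *\<^sub>R x + n) * h n \<partial>P) = h n * measure P {x. s *\<^sub>R x + n \<in> B}"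
        by (simp add: mult.commute)
    qed simp
    also have "\<dots> = (\<integral>n. h n * G n \<partial>Q)"
    proof -
      have "(\<integral>n. h n \<partial>Q) = 0" using h0 by (simp add: Q_def integral_distr)
      then show ?thesis using iQ by (simp add: G_def right_diff_distrib)
    qed
    also have "\<bar>\<dots>\<bar> \<le> (\<integral>n. R * (c + indicator {n. real k < norm n} n) \<partial>Q)"
    proof (intro integral_abs_bound[THEN order_trans] integral_mono integrable_abs iQ)
      show "\<bar>h n * G n\<bar> \<le> R * (c + indicator {n. real k < norm n} n)" for n
        unfolding abs_mult using hR Gb R by (intro mult_mono) auto
      show "integrable Q (\<lambda>n. R * (c + indicator {n. real k < norm n} n))"
        using c R by (intro Q.integrable_const_bound[of _ "R * (c + 1)"])
          (auto simp: abs_mult indicator_def intro!: mult_left_mono)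
    qed
    \<comment> \<open>One \<open>c\<close> is the constant; the other bounds the tail probability
      fixed by the choice of \<open>k\<close>.\<close>
    also have "\<dots> \<le> R * (c + c)"
    proof -
      have "integrable Q (\<lambda>n. indicator {n. real k < norm n} n :: real)"
        by (rule Q.integrable_const_bound[of _ 1]) (auto simp: indicator_def)
      then have "(\<integral>n. R * (c + indicator {n. real k < norm n} n) \<partial>Q)
          = R * (c + (\<integral>n. indicator {n. real k < norm n} n \<partial>Q))"
        by (subst integral_mult_right_zero, subst Bochner_Integration.integral_add)
          (auto simp: Q.prob_space)
      then show ?thesis using k R by (simp only: mult_left_mono less_imp_le add_left_mono)
    qed
    also have "\<dots> \<le> (R + 1) * (c + c)"
      using c by (intro mult_right_mono) auto
    also have "\<dots> = e"
    proof -
      have "2 * (R + 1) \<noteq> 0" using R by simp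
      then have "2 * (R + 1) * c = e" unfolding c_def by (metis nonzero_mult_div_cancel_left times_divide_eq_right)
      then show ?thesis by (simp add: algebra_simps)
    qed
    finally show ?thesis .
  qed
  moreover have "\<forall>\<^sub>F t in at_top. sqrt t > 0 \<and> k / d < sqrt t"
    using filterlim_at_top_dense[THEN iffD1, OF sqrt_at_top] by (auto intro: eventually_conj)
  ultimately show ?thesis
    by (auto elim!: eventually_mono)
qed

section \<open>Second moments of conditional expectations\<close>

context finite_measure_subalgebra
begin

text \<open>Conditional expectation is an orthogonal projection in L^2. Jensen gives square
  integrability, pulling out the \<open>F\<close>-measurable factor shows that the mixed moment
  equals that of the projection squared, and Pythagoras then yields the contraction bound.\<close>

lemma real_cond_exp_square:
  assumes [measurable]: "W \<in> borel_measurable M" and W2: "integrable M (\<lambda>x. (W x)\<^sup>2)"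
  shows "integrable M (\<lambda>x. (real_cond_exp M F W x)\<^sup>2)"
    and "(\<integral>x. (real_cond_exp M F W x)\<^sup>2 \<partial>M) \<le> (\<integral>x. (W x)\<^sup>2 \<partial>M)"
    and "integrable M (\<lambda>x. (W x - real_cond_exp M F W x)\<^sup>2)"
    and "(\<integral>x. (W x - real_cond_exp M F W x)\<^sup>2 \<partial>M)
       = (\<integral>x. (W x)\<^sup>2 \<partial>M) - (\<integral>x. (real_cond_exp M F W x)\<^sup>2 \<partial>M)"
proof -
  let ?Z = "real_cond_exp M F W"
  have W: "integrable M W" by (rule square_integrable_imp_integrable) (use W2 in auto)
  have cx: "convex_on UNIV (\<lambda>x::real. x\<^sup>2)" by (rule convex_power2)
  show Z2: "integrable M (\<lambda>x. (?Z x)\<^sup>2)"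
    by (rule integrable_convex_cond_exp[where I = UNIV]) (use W W2 cx in auto)
  \<comment> \<open>Integrability of the product is the condition for pulling \<open>?Z\<close> out
    of the conditional expectation.\<close>
  have "integrable M (\<lambda>x. W x * ?Z x)"
  proof (rule Bochner_Integration.integrable_bound)
    show "integrable M (\<lambda>x. (W x)\<^sup>2 + (?Z x)\<^sup>2)" using W2 Z2 by simp
    show "AE x in M. norm (W x * ?Z x) \<le> norm ((W x)\<^sup>2 + (?Z x)\<^sup>2)"
    proof (rule AE_I2)
      fix x
      show "norm (W x * ?Z x) \<le> norm ((W x)\<^sup>2 + (?Z x)\<^sup>2)"
        using sum_squares_bound[of "\<bar>W x\<bar>" "\<bar>?Z x\<bar>"] abs_ge_zero[of "W x * ?Z x"]
        by (simp only: real_norm_def abs_mult power2_abs abs_of_nonneg[OF sum_power2_ge_zero])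
    qed
  qed simp
  then have i: "integrable M (\<lambda>x. ?Z x * W x)" by (simp add: mult.commute)
  have eq: "(\<integral>x. ?Z x * W x \<partial>M) = (\<integral>x. (?Z x)\<^sup>2 \<partial>M)"
    using real_cond_exp_intg(2)[OF i] by (simp add: power2_eq_square)
  have ex: "(W x - ?Z x)\<^sup>2 = (W x)\<^sup>2 - 2 * (?Z x * W x) + (?Z x)\<^sup>2" for x
    by (simp add: power2_eq_square algebra_simps)
  show "integrable M (\<lambda>x. (W x - ?Z x)\<^sup>2)" unfolding ex using W2 Z2 i by auto
  show pyth: "(\<integral>x. (W x - ?Z x)\<^sup>2 \<partial>M) = (\<integral>x. (W x)\<^sup>2 \<partial>M) - (\<integral>x. (?Z x)\<^sup>2 \<partial>M)"
    unfolding ex using W2 Z2 i eq by simp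
  have "0 \<le> (\<integral>x. (W x - ?Z x)\<^sup>2 \<partial>M)" by simp
  then show "(\<integral>x. (?Z x)\<^sup>2 \<partial>M) \<le> (\<integral>x. (W x)\<^sup>2 \<partial>M)" unfolding pyth by simp
qed

text \<open>The L^1 norm of the conditional expectation is found by testing on the two events where
  it is positive or not. Both lie in \<open>F\<close>, so \<open>W\<close> may be integrated there
  instead, giving at most \<open>2 * e\<close>. The bound \<open>R\<close> passes to the conditional
  expectation and turns this into an L^2 estimate.\<close>

lemma real_cond_exp_square_le_of_bounded:
  assumes [measurable]: "W \<in> borel_measurable M" and WR: "\<And>x. \<bar>W x\<bar> \<le> R"
    and A: "\<And>A. A \<in> sets F \<Longrightarrow> \<bar>\<integral>x. indicator A x * W x \<partial>M\<bar> \<le> e"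
  shows "(\<integral>x. (real_cond_exp M F W x)\<^sup>2 \<partial>M) \<le> 2 * R * e"
proof -
  let ?Z = "real_cond_exp M F W"
  have R: "0 \<le> R" using WR[of undefined] by linarith
  have W: "integrable M W" by (rule integrable_const_bound[of _ R]) (auto simp: WR)
  have Z: "integrable M ?Z" using W by (rule real_cond_exp_int(1))
  have "AE x in M. ?Z x \<le> R" "AE x in M. - R \<le> ?Z x"
    by (rule real_cond_exp_le_c real_cond_exp_ge_c; use W WR in \<open>auto simp: abs_le_iff minus_le_iff\<close>)+
  then have ZR: "AE x in M. \<bar>?Z x\<bar> \<le> R" by eventually_elim auto
  define A1 A2 where "A1 = {x\<in>space F. 0 < ?Z x}" and "A2 = {x\<in>space F. ?Z x \<le> 0}"
  have AF[measurable]: "A1 \<in> sets F" "A2 \<in> sets F" unfolding A1_def A2_def by measurable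
  then have AM[measurable]: "A1 \<in> sets M" "A2 \<in> sets M" using subalg by (auto simp: subalgebra_def)
  have iA: "integrable M (\<lambda>x. indicator A x * f x)" if "A \<in> sets M" "integrable M f" for A and f :: "_ \<Rightarrow> real"
    using integrable_mult_indicator[of A M f] that by simp
  have "(\<integral>x. \<bar>?Z x\<bar> \<partial>M) = (\<integral>x. indicator A1 x * ?Z x - indicator A2 x * ?Z x \<partial>M)"
    using subalg by (intro Bochner_Integration.integral_cong)
      (auto simp: A1_def A2_def indicator_def subalgebra_def)
  also have "\<dots> = (\<integral>x. indicator A1 x * ?Z x \<partial>M) - (\<integral>x. indicator A2 x * ?Z x \<partial>M)"
    using iA Z AM by simp
  also have "\<dots> = (\<integral>x. indicator A1 x * W x \<partial>M) - (\<integral>x. indicator A2 x * W x \<partial>M)"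
    using iA W AM AF by (simp add: real_cond_exp_intg(2))
  also have "\<dots> \<le> 2 * e" using A[OF AF(1)] A[OF AF(2)] by linarith
  finally have Z1: "(\<integral>x. \<bar>?Z x\<bar> \<partial>M) \<le> 2 * e" .
  have "(\<integral>x. (?Z x)\<^sup>2 \<partial>M) \<le> (\<integral>x. R * \<bar>?Z x\<bar> \<partial>M)"
  proof (rule integral_mono_AE)
    show "AE x in M. (?Z x)\<^sup>2 \<le> R * \<bar>?Z x\<bar>"
      using ZR by eventually_elim (metis abs_ge_zero abs_mult_self_eq mult_right_mono power2_eq_square)
    show "integrable M (\<lambda>x. (?Z x)\<^sup>2)"
      by (rule real_cond_exp_square(1))
        (auto intro!: integrable_const_bound[of _ "R\<^sup>2"] simp: WR abs_le_square_iff[symmetric] R)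
  qed (use Z in auto)
  also have "\<dots> \<le> R * (2 * e)" using Z1 R by (simp add: mult_left_mono)
  finally show ?thesis by simp
qed

text \<open>The two summands are treated differently on purpose: \<open>V\<close> will be the
  bounded part, whose conditional expectation is small, and \<open>W\<close> the remainder, itself
  small in L^2, for which contraction suffices.\<close>

lemma real_cond_exp_add_square_le:
  assumes [measurable]: "V \<in> borel_measurable M" "W \<in> borel_measurable M"
    and 2: "integrable M (\<lambda>x. (V x)\<^sup>2)" "integrable M (\<lambda>x. (W x)\<^sup>2)"
  shows "(\<integral>x. (real_cond_exp M F (\<lambda>x. V x + W x) x)\<^sup>2 \<partial>M)
     \<le> 2 * (\<integral>x. (real_cond_exp M F V x)\<^sup>2 \<partial>M) + 2 * (\<integral>x. (W x)\<^sup>2 \<partial>M)"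
proof -
  let ?V = "real_cond_exp M F V" and ?W = "real_cond_exp M F W"
  have i: "integrable M V" "integrable M W"
    by (rule square_integrable_imp_integrable; use 2 in simp)+
  have "AE x in M. real_cond_exp M F (\<lambda>x. V x + W x) x = ?V x + ?W x"
    using i by (rule real_cond_exp_add)
  then have "(\<integral>x. (real_cond_exp M F (\<lambda>x. V x + W x) x)\<^sup>2 \<partial>M) = (\<integral>x. (?V x + ?W x)\<^sup>2 \<partial>M)"
    by (intro integral_cong_AE) auto
  also have "\<dots> \<le> (\<integral>x. 2 * (?V x)\<^sup>2 + 2 * (?W x)\<^sup>2 \<partial>M)"
  proof (rule integral_mono_AE')
    show "AE x in M. (?V x + ?W x)\<^sup>2 \<le> 2 * (?V x)\<^sup>2 + 2 * (?W x)\<^sup>2"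
    proof (rule AE_I2)
      fix x
      show "(?V x + ?W x)\<^sup>2 \<le> 2 * (?V x)\<^sup>2 + 2 * (?W x)\<^sup>2"
        using sum_squares_bound[of "?V x" "?W x"] by (simp add: power2_sum)
    qed
  qed (use real_cond_exp_square(1) 2 in auto)
  also have "\<dots> = 2 * (\<integral>x. (?V x)\<^sup>2 \<partial>M) + 2 * (\<integral>x. (?W x)\<^sup>2 \<partial>M)"
    using real_cond_exp_square(1) 2 by simp
  also have "\<dots> \<le> 2 * (\<integral>x. (?V x)\<^sup>2 \<partial>M) + 2 * (\<integral>x. (W x)\<^sup>2 \<partial>M)"
    using real_cond_exp_square(2)[of W] 2 by simp
  finally show ?thesis .
qed

end

section \<open>Vanishing of the conditional expectation of centred noise\<close>

lemma (in prob_space) finite_measure_subalgebra_vimage: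
  fixes Y :: "'a \<Rightarrow> 'b::topological_space"
  assumes "Y \<in> borel_measurable M"
  shows "finite_measure_subalgebra M (vimage_algebra (space M) Y borel)"
proof
  show "subalgebra M (vimage_algebra (space M) Y borel)"
    using measurable_sets[OF assms] by (auto simp: subalgebra_def sets_vimage_algebra2)
qed

lemma (in prob_space) noise_cond_exp_square_tendsto_zero:
  fixes X N :: "'a \<Rightarrow> 'b::euclidean_space" and h :: "'b \<Rightarrow> real"
  assumes [measurable]: "random_variable borel X" "random_variable borel N" "h \<in> borel_measurable borel"
    and ind: "indep_var borel X borel N" and ac: "absolutely_continuous lborel (distr M lborel X)"
    and h2: "integrable M (\<lambda>\<omega>. (h (N \<omega>))\<^sup>2)" and h0: "expectation (\<lambda>\<omega>. h (N \<omega>)) = 0"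
  shows "((\<lambda>t. \<integral>\<omega>. (real_cond_exp M (vimage_algebra (space M) (\<lambda>\<omega>. sqrt t *\<^sub>R X \<omega> + N \<omega>) borel)
      (\<lambda>\<omega>. h (N \<omega>)) \<omega>)\<^sup>2 \<partial>M) \<longlongrightarrow> 0) at_top"
proof (rule order_tendstoI)
  define F where "F t = vimage_algebra (space M) (\<lambda>\<omega>. sqrt t *\<^sub>R X \<omega> + N \<omega>) borel" for t
  fix e :: real assume "0 < e"
  have "\<forall>\<^sub>F k in sequentially. (\<integral>\<omega>. indicator {\<omega>. real k < \<bar>h (N \<omega>)\<bar>} \<omega> * (h (N \<omega>))\<^sup>2 \<partial>M) < e/4"
    using \<open>0 < e\<close> h2 by (intro order_tendstoD(2)[OF integral_tail_tendsto_zero]) auto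
  then obtain k :: nat where k: "(\<integral>\<omega>. indicator {\<omega>. real k < \<bar>h (N \<omega>)\<bar>} \<omega> * (h (N \<omega>))\<^sup>2 \<partial>M) < e/4"
    using eventually_happens by fastforce
  define lo where "lo n = (if \<bar>h n\<bar> \<le> k then h n else 0)" for n
  define hi where "hi n = (if \<bar>h n\<bar> \<le> k then 0 else h n)" for n
  define c where "c = expectation (\<lambda>\<omega>. lo (N \<omega>))"
  \<comment> \<open>The summand 1 makes \<open>R\<close> positive, so that it can be divided
    by.\<close>
  define R where "R = real k + \<bar>c\<bar> + 1"
  have [measurable]: "lo \<in> borel_measurable borel" "hi \<in> borel_measurable borel"
    unfolding lo_def hi_def by measurable
  \<comment> \<open>Truncation destroys centring, so the mean \<open>c\<close> of \<open>lo\<close>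
    is moved to the other part; both summands then have mean 0.\<close>
  have h_split: "h n = (lo n - c) + (hi n + c)" for n by (simp add: lo_def hi_def)
  have hi2: "(hi (N \<omega>))\<^sup>2 = indicator {\<omega>. real k < \<bar>h (N \<omega>)\<bar>} \<omega> * (h (N \<omega>))\<^sup>2" for \<omega>
    by (simp add: hi_def indicator_def)
  have hi2i: "integrable M (\<lambda>\<omega>. (hi (N \<omega>))\<^sup>2)"
    by (rule Bochner_Integration.integrable_bound[OF h2]) (auto simp: hi_def)
  have hi1i: "integrable M (\<lambda>\<omega>. hi (N \<omega>))"
    by (rule square_integrable_imp_integrable) (use hi2i in auto)
  have lo1i: "integrable M (\<lambda>\<omega>. lo (N \<omega>))"
    by (rule integrable_const_bound[of _ k]) (auto simp: lo_def)
  have R: "\<bar>lo n - c\<bar> \<le> R" "0 < R" for n by (auto simp: R_def lo_def)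
  have Ehi: "expectation (\<lambda>\<omega>. hi (N \<omega>)) = - c"
  proof -
    have "expectation (\<lambda>\<omega>. h (N \<omega>)) = expectation (\<lambda>\<omega>. lo (N \<omega>) + hi (N \<omega>))"
      by (intro Bochner_Integration.integral_cong) (auto simp: lo_def hi_def)
    then show ?thesis using h0 lo1i hi1i by (simp add: c_def)
  qed
  have hic2: "(hi (N \<omega>) + c)\<^sup>2 = (hi (N \<omega>))\<^sup>2 + 2 * c * hi (N \<omega>) + c\<^sup>2" for \<omega>
    by (simp add: power2_eq_square algebra_simps)
  have hic2i: "integrable M (\<lambda>\<omega>. (hi (N \<omega>) + c)\<^sup>2)"
    unfolding hic2 using hi2i hi1i by simp
  \<comment> \<open>Since \<open>hi\<close> has mean \<open>- c\<close>, this is its variance, which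
    is at most its second moment.\<close>
  have "expectation (\<lambda>\<omega>. (hi (N \<omega>) + c)\<^sup>2) = expectation (\<lambda>\<omega>. (hi (N \<omega>))\<^sup>2) - c\<^sup>2"
    unfolding hic2 using hi2i hi1i Ehi by (simp add: prob_space power2_eq_square)
  then have small: "expectation (\<lambda>\<omega>. (hi (N \<omega>) + c)\<^sup>2) < e/4"
    using k by (simp add: hi2) (smt (verit) zero_le_power2)
  have lo2i: "integrable M (\<lambda>\<omega>. (lo (N \<omega>) - c)\<^sup>2)"
    by (rule integrable_const_bound[of _ "R\<^sup>2"]) (use R in \<open>auto simp: abs_le_square_iff[symmetric]\<close>)
  have "expectation (\<lambda>\<omega>. lo (N \<omega>) - c) = 0" using lo1i by (simp add: c_def prob_space)
  \<comment> \<open>Chosen so that \<open>2 * R * (e / (8 * R))\<close> is \<open>e/4\<close>;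
    doubling both quarter bounds, one of them strict, ends below \<open>e\<close>.\<close>
  moreover have "0 < e / (8 * R)" using R \<open>0 < e\<close> by simp
  ultimately have "\<forall>\<^sub>F t in at_top. \<forall>B\<in>sets borel.
      \<bar>expectation (\<lambda>\<omega>. indicator B (sqrt t *\<^sub>R X \<omega> + N \<omega>) * (lo (N \<omega>) - c))\<bar> \<le> e / (8 * R)"
    using R(1) by (intro indep_noise_asymp_uncorrelated ind ac) auto
  then show "\<forall>\<^sub>F t in at_top. (\<integral>\<omega>. (real_cond_exp M (vimage_algebra (space M)
      (\<lambda>\<omega>. sqrt t *\<^sub>R X \<omega> + N \<omega>) borel) (\<lambda>\<omega>. h (N \<omega>)) \<omega>)\<^sup>2 \<partial>M) < e"
    unfolding F_def[symmetric]
  proof eventually_elim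
    case (elim t)
    interpret F: finite_measure_subalgebra M "F t"
      unfolding F_def by (rule finite_measure_subalgebra_vimage) simp
    have "\<bar>\<integral>\<omega>. indicator A \<omega> * (lo (N \<omega>) - c) \<partial>M\<bar> \<le> e / (8 * R)" if "A \<in> sets (F t)" for A
    proof -
      from that obtain B where B: "B \<in> sets borel"
        "A = (\<lambda>\<omega>. sqrt t *\<^sub>R X \<omega> + N \<omega>) -` B \<inter> space M"
        by (auto simp: F_def sets_vimage_algebra2)
      have "(\<integral>\<omega>. indicator A \<omega> * (lo (N \<omega>) - c) \<partial>M)
          = expectation (\<lambda>\<omega>. indicator B (sqrt t *\<^sub>R X \<omega> + N \<omega>) * (lo (N \<omega>) - c))"
        by (intro Bochner_Integration.integral_cong) (auto simp: B(2) indicator_def)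
      then show ?thesis using elim B(1) by simp
    qed
    then have "(\<integral>\<omega>. (real_cond_exp M (F t) (\<lambda>\<omega>. lo (N \<omega>) - c) \<omega>)\<^sup>2 \<partial>M) \<le> 2 * R * (e / (8 * R))"
      using R(1) by (intro F.real_cond_exp_square_le_of_bounded) auto
    also have "\<dots> = e/4" using R(2) by simp
    finally have "(\<integral>\<omega>. (real_cond_exp M (F t) (\<lambda>\<omega>. lo (N \<omega>) - c) \<omega>)\<^sup>2 \<partial>M) \<le> e/4" .
    moreover have "(\<integral>\<omega>. (real_cond_exp M (F t) (\<lambda>\<omega>. h (N \<omega>)) \<omega>)\<^sup>2 \<partial>M)
       \<le> 2 * (\<integral>\<omega>. (real_cond_exp M (F t) (\<lambda>\<omega>. lo (N \<omega>) - c) \<omega>)\<^sup>2 \<partial>M) + 2 * (\<integral>\<omega>. (hi (N \<omega>) + c)\<^sup>2 \<partial>M)"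
      unfolding h_split by (rule F.real_cond_exp_add_square_le) (use lo2i hic2i in auto)
    ultimately show ?case using small by linarith
  qed
\<comment> \<open>The other half of the limit: a second moment is nonnegative and so exceeds every
  negative bound.\<close>
qed (auto intro!: always_eventually elim: less_le_trans)

section \<open>The exact error identity and passage to the limit\<close>

theorem theorem10:
  fixes M :: "'a measure" and X N :: "'a \<Rightarrow> real^'m"
    and p :: "real^'m \<Rightarrow> ennreal" and C :: real
  assumes "prob_space M"
    and "X \<in> borel_measurable M"
    and "N \<in> borel_measurable M"
    and "prob_space.indep_var M borel X borel N"
    and "integrable M (\<lambda>\<omega>. (norm (X \<omega>))\<^sup>2)"
    and "integrable M (\<lambda>\<omega>. (norm (N \<omega>))\<^sup>2)"
    and "absolutely_continuous lborel (distr M lborel X)"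
    and "absolutely_continuous lborel (distr M lborel N)"
    and "distributed M lborel N p"
    and "\<And>u. p u \<le> ennreal (C / (1 + norm u ^ (CARD('m) + 2)))"
  shows "((\<lambda>t. t * mmse M X (\<lambda>\<omega>. sqrt t *\<^sub>R X \<omega> + N \<omega>))
           \<longlongrightarrow> (\<Sum>i\<in>UNIV. var M (\<lambda>\<omega>. N \<omega> $ i))) at_top"
proof -
  interpret prob_space M by fact
  have [measurable]: "X \<in> borel_measurable M" "N \<in> borel_measurable M" by fact+
  note [measurable (raw)] = measurable_compose[OF _ borel_measurable_nth]
  have comp2: "integrable M (\<lambda>\<omega>. (V \<omega> $ i)\<^sup>2)"
    if [measurable]: "V \<in> borel_measurable M" and V: "integrable M (\<lambda>\<omega>. (norm (V \<omega>))\<^sup>2)"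
    for V :: "'a \<Rightarrow> real^'m" and i
    by (rule Bochner_Integration.integrable_bound[OF V])
      (measurable, auto intro: power_mono[OF component_le_norm_cart, of _ _ 2, simplified])
  define \<mu> where "\<mu> i = expectation (\<lambda>\<omega>. N \<omega> $ i)" for i
  define W where "W i \<omega> = N \<omega> $ i - \<mu> i" for i \<omega>
  define F where "F t = vimage_algebra (space M) (\<lambda>\<omega>. sqrt t *\<^sub>R X \<omega> + N \<omega>) borel" for t
  have [measurable]: "W i \<in> borel_measurable M" for i unfolding W_def by measurable
  have X2: "integrable M (\<lambda>\<omega>. (X \<omega> $ i)\<^sup>2)" and N2: "integrable M (\<lambda>\<omega>. (N \<omega> $ i)\<^sup>2)" for i
    using comp2 assms(5,6) by auto
  have X1: "integrable M (\<lambda>\<omega>. X \<omega> $ i)" and N1: "integrable M (\<lambda>\<omega>. N \<omega> $ i)" for i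
    by (rule square_integrable_imp_integrable; use X2 N2 in simp)+
  have W2: "integrable M (\<lambda>\<omega>. (W i \<omega>)\<^sup>2)" for i
    using N2[of i] N1[of i] by (simp add: W_def power2_diff)
  have W1: "integrable M (W i)" for i using N1[of i] by (simp add: W_def[abs_def])
  have EW: "expectation (W i) = 0" for i using N1[of i] by (simp add: W_def[abs_def] \<mu>_def prob_space)
  have var_eq: "var M (\<lambda>\<omega>. N \<omega> $ i) = expectation (\<lambda>\<omega>. (W i \<omega>)\<^sup>2)" for i
    by (simp add: var_def W_def \<mu>_def)

  have lim: "((\<lambda>t. \<integral>\<omega>. (real_cond_exp M (F t) (W i) \<omega>)\<^sup>2 \<partial>M) \<longlongrightarrow> 0) at_top" for i
    unfolding F_def W_def[abs_def]
    by (rule noise_cond_exp_square_tendsto_zero[where h = "\<lambda>n. n $ i - \<mu> i"])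
      (use assms(4,7) W2[of i] EW[of i] in \<open>auto simp: W_def[abs_def]\<close>)

  \<comment> \<open>This identity is exact for every positive \<open>t\<close>; only the subtracted
    second moments depend on \<open>t\<close>.\<close>
  have "t * mmse M X (\<lambda>\<omega>. sqrt t *\<^sub>R X \<omega> + N \<omega>)
     = (\<Sum>i\<in>UNIV. var M (\<lambda>\<omega>. N \<omega> $ i) - (\<integral>\<omega>. (real_cond_exp M (F t) (W i) \<omega>)\<^sup>2 \<partial>M))"
    if t: "0 < t" for t
  proof -
    interpret F: finite_measure_subalgebra M "F t"
      unfolding F_def by (rule finite_measure_subalgebra_vimage) simp
    have YF: "(\<lambda>\<omega>. sqrt t *\<^sub>R X \<omega> + N \<omega>) \<in> borel_measurable (F t)"
      unfolding F_def by (rule measurable_vimage_algebra1) simp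
    have err: "AE \<omega> in M. X \<omega> $ i - real_cond_exp M (F t) (\<lambda>\<omega>. X \<omega> $ i) \<omega>
        = - (W i \<omega> - real_cond_exp M (F t) (W i) \<omega>) / sqrt t" for i
    proof -
      \<comment> \<open>\<open>U\<close> is a function of the observation alone, hence fixed by the
        conditional expectation; only the centred noise term contributes to the error.\<close>
      define U where "U \<omega> = ((sqrt t *\<^sub>R X \<omega> + N \<omega>) $ i - \<mu> i) / sqrt t" for \<omega>
      have X_eq: "X \<omega> $ i = U \<omega> - W i \<omega> / sqrt t" for \<omega>
        using t by (simp add: U_def W_def field_simps)
      have U1: "integrable M U" using X1[of i] N1[of i] by (simp add: U_def[abs_def])
      have UF: "U \<in> borel_measurable (F t)"
        unfolding U_def using YF by (intro borel_measurable_divide borel_measurable_diff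
            measurable_compose[OF YF borel_measurable_nth]) auto
      have "AE \<omega> in M. real_cond_exp M (F t) (\<lambda>\<omega>. X \<omega> $ i) \<omega>
          = real_cond_exp M (F t) U \<omega> - real_cond_exp M (F t) (\<lambda>\<omega>. W i \<omega> / sqrt t) \<omega>"
        unfolding X_eq using U1 W1[of i] by (intro F.real_cond_exp_diff) auto
      moreover have "AE \<omega> in M. real_cond_exp M (F t) U \<omega> = U \<omega>"
        using U1 UF by (rule F.real_cond_exp_F_meas)
      moreover have "AE \<omega> in M. real_cond_exp M (F t) (\<lambda>\<omega>. W i \<omega> / sqrt t) \<omega>
          = real_cond_exp M (F t) (W i) \<omega> / sqrt t"
        using W1 by (rule F.real_cond_exp_cdiv)
      ultimately show ?thesis
        by eventually_elim (use t in \<open>simp add: X_eq field_simps\<close>)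
    qed
    have "mmse M X (\<lambda>\<omega>. sqrt t *\<^sub>R X \<omega> + N \<omega>)
      = (\<integral>\<omega>. (\<Sum>i\<in>UNIV. (X \<omega> $ i - real_cond_exp M (F t) (\<lambda>\<omega>. X \<omega> $ i) \<omega>)\<^sup>2) \<partial>M)"
      by (simp add: mmse_def vec_cond_exp_def F_def norm_vec_def L2_set_def sum_nonneg)
    also have "\<dots> = (\<Sum>i\<in>UNIV. \<integral>\<omega>. (X \<omega> $ i - real_cond_exp M (F t) (\<lambda>\<omega>. X \<omega> $ i) \<omega>)\<^sup>2 \<partial>M)"
      using F.real_cond_exp_square(3) X2 by (intro Bochner_Integration.integral_sum) simp
    also have "\<dots> = (\<Sum>i\<in>UNIV. (\<integral>\<omega>. (W i \<omega> - real_cond_exp M (F t) (W i) \<omega>)\<^sup>2 \<partial>M) / t)"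
    proof (rule sum.cong)
      fix i
      have "(\<integral>\<omega>. (X \<omega> $ i - real_cond_exp M (F t) (\<lambda>\<omega>. X \<omega> $ i) \<omega>)\<^sup>2 \<partial>M)
         = (\<integral>\<omega>. (W i \<omega> - real_cond_exp M (F t) (W i) \<omega>)\<^sup>2 / t \<partial>M)"
      \<comment> \<open>Conditional expectations are determined only almost everywhere. Squaring
        removes the sign and turns \<open>sqrt t\<close> into \<open>t\<close>.\<close>
      proof (rule integral_cong_AE)
        show "AE \<omega> in M. (X \<omega> $ i - real_cond_exp M (F t) (\<lambda>\<omega>. X \<omega> $ i) \<omega>)\<^sup>2
            = (W i \<omega> - real_cond_exp M (F t) (W i) \<omega>)\<^sup>2 / t"
          using err[of i] by eventually_elim (use t in \<open>simp add: power_divide power2_commute\<close>)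
      qed auto
      then show "(\<integral>\<omega>. (X \<omega> $ i - real_cond_exp M (F t) (\<lambda>\<omega>. X \<omega> $ i) \<omega>)\<^sup>2 \<partial>M)
         = (\<integral>\<omega>. (W i \<omega> - real_cond_exp M (F t) (W i) \<omega>)\<^sup>2 \<partial>M) / t" by simp
    qed simp
    also have "t * \<dots> = (\<Sum>i\<in>UNIV. \<integral>\<omega>. (W i \<omega> - real_cond_exp M (F t) (W i) \<omega>)\<^sup>2 \<partial>M)"
      using t by (simp flip: sum_divide_distrib)
    \<comment> \<open>Pythagoras in each coordinate, where the second moment of \<open>W i\<close>
      is the variance of the noise component.\<close>
    finally show ?thesis
      using F.real_cond_exp_square(4) W2 by (simp add: var_eq)
  qed
  then have "\<forall>\<^sub>F t in at_top. (\<Sum>i\<in>UNIV. var M (\<lambda>\<omega>. N \<omega> $ i) - (\<integral>\<omega>. (real_cond_exp M (F t) (W i) \<omega>)\<^sup>2 \<partial>M))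
     = t * mmse M X (\<lambda>\<omega>. sqrt t *\<^sub>R X \<omega> + N \<omega>)"
    by (intro eventually_mono[OF eventually_gt_at_top[of 0]]) simp
  moreover have "((\<lambda>t. \<Sum>i\<in>UNIV. var M (\<lambda>\<omega>. N \<omega> $ i) - (\<integral>\<omega>. (real_cond_exp M (F t) (W i) \<omega>)\<^sup>2 \<partial>M))
      \<longlongrightarrow> (\<Sum>i\<in>UNIV. var M (\<lambda>\<omega>. N \<omega> $ i) - 0)) at_top"
    by (intro tendsto_sum tendsto_diff tendsto_const lim)
  ultimately show ?thesis
    by (simp add: Lim_transform_eventually)
qed

end
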